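(* Let $\mathcal{K}$ be a category whose objects are preorders $\mathcal{C}$, each equipped with a Grothendieck topology $J_{\mathcal{C}}$, and whose arrows $\mathcal{C}\to\mathcal{D}$ are (certain) monotone maps, such that every arrow $f:\mathcal{C}\to\mathcal{D}$ of $\mathcal{K}$ is a morphism of sites $(\mathcal{C},J_{\mathcal{C}})\to(\mathcal{D},J_{\mathcal{D}})$. Let $A:\mathcal{K}^{\mathrm{op}}\to\mathbf{Loc}$ be the functor sending $\mathcal{C}$ to the locale $\mathrm{Id}_{J_{\mathcal{C}}}(\mathcal{C})$ of $J_{\mathcal{C}}$-ideals on $\mathcal{C}$ and $f:\mathcal{C}\to\mathcal{D}$ to the locale morphism $\mathrm{Id}_{J_{\mathcal{D}}}(\mathcal{D})\to\mathrm{Id}_{J_{\mathcal{C}}}(\mathcal{C})$ whose associated frame homomorphism sends a $J_{\mathcal{C}}$-ideal $I$ to the smallest $J_{\mathcal{D}}$-ideal containing $f(I)$. If all the Grothendieck topologies $J_{\mathcal{C}}$ are subcanonical and all the preorders in $\mathcal{K}$ are posets, then $A$ yields an isomorphism of categories between $\mathcal{K}^{\mathrm{op}}$ and the subcategory of $\mathbf{Loc}$ given by the image of $A$ (whose objects are those of the form $A(\mathcal{C})$ and whose arrows are those of the form $A(f)$).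
   Context: Preorders are regarded as categories; a sieve on $c\in\mathcal{C}$ is a lower subset of $\{d\mid d\le c\}$. A $J$-ideal on $\mathcal{C}$ is a lower set $I\subseteq\mathcal{C}$ such that whenever all elements of some $J$-covering sieve on $c$ belong to $I$, also $c\in I$; the set $\mathrm{Id}_J(\mathcal{C})$ of $J$-ideals, ordered by inclusion, is a frame, regarded as a locale. A morphism of sites $f:(\mathcal{C},J_{\mathcal{C}})\to(\mathcal{D},J_{\mathcal{D}})$ between preorders is a monotone map which is flat, i.e. (1) for every $d\in\mathcal{D}$ there is $c\in\mathcal{C}$ with $d\le f(c)$, and (2) whenever $d\le f(c)$ and $d\le f(c')$ there is $c''\le c,c'$ with $d\le f(c'')$; and cover-preserving, i.e. the image of every $J_{\mathcal{C}}$-covering sieve generates a $J_{\mathcal{D}}$-covering sieve. $J$ is subcanonical if for every $J$-covering sieve $S$ on $c$, $c$ is a supremum of $S$ in $\mathcal{C}$. $\mathbf{Loc}$ is the category of locales (the opposite of the category of frames). *)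

theory Defs
  imports "HOL.Hull" "HOL-Library.FuncSet" "HOL-Algebra.Complete_Lattice"
begin

section \<open>Categories\<close>

text \<open>Composition is written in the usual order: \<open>Comp C g f\<close> is ``\<open>g\<close> after \<open>f\<close>'',
  and is meaningful when \<open>Cod C f = Dom C g\<close>.\<close>

record ('o, 'm) cat =
  Obj :: "'o set"
  Arr :: "'m set"
  Dom :: "'m \<Rightarrow> 'o"
  Cod :: "'m \<Rightarrow> 'o"
  Ident :: "'o \<Rightarrow> 'm"
  Comp :: "'m \<Rightarrow> 'm \<Rightarrow> 'm"

locale category =
  fixes C :: "('o, 'm) cat"
  assumes dom_closed: "f \<in> Arr C \<Longrightarrow> Dom C f \<in> Obj C"
    and cod_closed: "f \<in> Arr C \<Longrightarrow> Cod C f \<in> Obj C"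
    and ident_closed: "X \<in> Obj C \<Longrightarrow> Ident C X \<in> Arr C"
    and dom_ident: "X \<in> Obj C \<Longrightarrow> Dom C (Ident C X) = X"
    and cod_ident: "X \<in> Obj C \<Longrightarrow> Cod C (Ident C X) = X"
    and comp_closed:
      "\<lbrakk>f \<in> Arr C; g \<in> Arr C; Cod C f = Dom C g\<rbrakk> \<Longrightarrow> Comp C g f \<in> Arr C"
    and dom_comp:
      "\<lbrakk>f \<in> Arr C; g \<in> Arr C; Cod C f = Dom C g\<rbrakk> \<Longrightarrow> Dom C (Comp C g f) = Dom C f"
    and cod_comp:
      "\<lbrakk>f \<in> Arr C; g \<in> Arr C; Cod C f = Dom C g\<rbrakk> \<Longrightarrow> Cod C (Comp C g f) = Cod C g"
    and comp_ident_right: "f \<in> Arr C \<Longrightarrow> Comp C f (Ident C (Dom C f)) = f"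
    and comp_ident_left: "f \<in> Arr C \<Longrightarrow> Comp C (Ident C (Cod C f)) f = f"
    and comp_assoc:
      "\<lbrakk>f \<in> Arr C; g \<in> Arr C; h \<in> Arr C; Cod C f = Dom C g; Cod C g = Dom C h\<rbrakk>
        \<Longrightarrow> Comp C h (Comp C g f) = Comp C (Comp C h g) f"

definition op_cat :: "('o, 'm) cat \<Rightarrow> ('o, 'm) cat" where
  "op_cat C = \<lparr>Obj = Obj C, Arr = Arr C, Dom = Cod C, Cod = Dom C,
     Ident = Ident C, Comp = (\<lambda>g f. Comp C f g)\<rparr>"

definition subcategory :: "('o, 'm) cat \<Rightarrow> ('o, 'm) cat \<Rightarrow> bool" where
  "subcategory S C \<longleftrightarrow>
     category S \<and> category C \<and> Obj S \<subseteq> Obj C \<and> Arr S \<subseteq> Arr C \<and>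
     (\<forall>f\<in>Arr S. Dom S f = Dom C f \<and> Cod S f = Cod C f) \<and>
     (\<forall>X\<in>Obj S. Ident S X = Ident C X) \<and>
     (\<forall>f\<in>Arr S. \<forall>g\<in>Arr S. Cod S f = Dom S g \<longrightarrow> Comp S g f = Comp C g f)"

definition is_functor ::
    "('o1, 'm1) cat \<Rightarrow> ('o2, 'm2) cat \<Rightarrow> ('o1 \<Rightarrow> 'o2) \<Rightarrow> ('m1 \<Rightarrow> 'm2) \<Rightarrow> bool" where
  "is_functor C D Fo Fm \<longleftrightarrow>
     category C \<and> category D \<and>
     (\<forall>X\<in>Obj C. Fo X \<in> Obj D) \<and>
     (\<forall>f\<in>Arr C. Fm f \<in> Arr D \<and> Dom D (Fm f) = Fo (Dom C f) \<and> Cod D (Fm f) = Fo (Cod C f)) \<and>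
     (\<forall>X\<in>Obj C. Fm (Ident C X) = Ident D (Fo X)) \<and>
     (\<forall>f\<in>Arr C. \<forall>g\<in>Arr C. Cod C f = Dom C g \<longrightarrow> Fm (Comp C g f) = Comp D (Fm g) (Fm f))"

definition is_cat_isomorphism ::
    "('o1, 'm1) cat \<Rightarrow> ('o2, 'm2) cat \<Rightarrow> ('o1 \<Rightarrow> 'o2) \<Rightarrow> ('m1 \<Rightarrow> 'm2) \<Rightarrow> bool" where
  "is_cat_isomorphism C D Fo Fm \<longleftrightarrow>
     is_functor C D Fo Fm \<and>
     (\<exists>Go Gm. is_functor D C Go Gm \<and>
        (\<forall>X\<in>Obj C. Go (Fo X) = X) \<and> (\<forall>f\<in>Arr C. Gm (Fm f) = f) \<and>
        (\<forall>Y\<in>Obj D. Fo (Go Y) = Y) \<and> (\<forall>g\<in>Arr D. Fm (Gm g) = g))"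

text \<open>The image of a functor need not be a subcategory (composites of arrows of the form
  \<open>Fm f\<close> may fail to be of this form), so this is a claim wherever it is used.\<close>

definition image_cat ::
    "('o1, 'm1) cat \<Rightarrow> ('o2, 'm2) cat \<Rightarrow> ('o1 \<Rightarrow> 'o2) \<Rightarrow> ('m1 \<Rightarrow> 'm2) \<Rightarrow> ('o2, 'm2) cat" where
  "image_cat C D Fo Fm = D\<lparr>Obj := Fo ` Obj C, Arr := Fm ` Arr C\<rparr>"

text \<open>Categories of structured sets: an arrow is a triple (source, target, function), where the
  function is extensional on the underlying set \<open>U X\<close> of its source, so that equal functions
  are equal arrows.\<close>

type_synonym ('o, 'a) arrow = "'o \<times> 'o \<times> ('a \<Rightarrow> 'a)"

definition concrete_cat ::
    "('o \<Rightarrow> 'a set) \<Rightarrow> 'o set \<Rightarrow> ('o \<Rightarrow> 'o \<Rightarrow> ('a \<Rightarrow> 'a) \<Rightarrow> bool) \<Rightarrow> ('o, ('o, 'a) arrow) cat" where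
  "concrete_cat U Ob Hom =
     \<lparr>Obj = Ob,
      Arr = {(X, Y, f). X \<in> Ob \<and> Y \<in> Ob \<and> f \<in> U X \<rightarrow>\<^sub>E U Y \<and> Hom X Y f},
      Dom = (\<lambda>(X, Y, f). X),
      Cod = (\<lambda>(X, Y, f). Y),
      Ident = (\<lambda>X. (X, X, \<lambda>x\<in>U X. x)),
      Comp = (\<lambda>(Y', Z, g) (X, Y, f). (X, Z, compose (U X) g f))\<rparr>"


section \<open>Frames and locales\<close>

text \<open>A preorder is given by its relation \<open>r\<close> alone; its set of elements is \<open>Field r\<close>, which by
  reflexivity loses nothing. The following gives access to suprema and infima in HOL-Algebra.\<close>

definition gorder_of :: "'a rel \<Rightarrow> 'a gorder" where
  "gorder_of r = \<lparr>carrier = Field r, eq = (=), le = (\<lambda>x y. (x, y) \<in> r)\<rparr>"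

definition frame :: "'a rel \<Rightarrow> bool" where
  "frame r \<longleftrightarrow> complete_lattice (gorder_of r) \<and>
     (\<forall>a\<in>Field r. \<forall>A. A \<subseteq> Field r \<longrightarrow>
        a \<sqinter>\<^bsub>gorder_of r\<^esub> (\<Squnion>\<^bsub>gorder_of r\<^esub> A)
          = \<Squnion>\<^bsub>gorder_of r\<^esub> ((\<lambda>b. a \<sqinter>\<^bsub>gorder_of r\<^esub> b) ` A))"

definition frame_hom :: "'a rel \<Rightarrow> 'b rel \<Rightarrow> ('a \<Rightarrow> 'b) \<Rightarrow> bool" where
  "frame_hom r s h \<longleftrightarrow>
     h \<in> Field r \<rightarrow> Field s \<and>
     h \<top>\<^bsub>gorder_of r\<^esub> = \<top>\<^bsub>gorder_of s\<^esub> \<and>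
     (\<forall>a\<in>Field r. \<forall>b\<in>Field r.
        h (a \<sqinter>\<^bsub>gorder_of r\<^esub> b) = h a \<sqinter>\<^bsub>gorder_of s\<^esub> h b) \<and>
     (\<forall>A. A \<subseteq> Field r \<longrightarrow> h (\<Squnion>\<^bsub>gorder_of r\<^esub> A) = \<Squnion>\<^bsub>gorder_of s\<^esub> (h ` A))"

definition Frm :: "('a rel, ('a rel, 'a) arrow) cat" where
  "Frm = concrete_cat Field {r. frame r} frame_hom"

definition Loc :: "('a rel, ('a rel, 'a) arrow) cat" where
  "Loc = op_cat Frm"


section \<open>Preorder sites\<close>

definition lower_set :: "'a rel \<Rightarrow> 'a set \<Rightarrow> bool" where
  "lower_set r L \<longleftrightarrow> L \<subseteq> Field r \<and> (\<forall>x\<in>L. \<forall>y. (y, x) \<in> r \<longrightarrow> y \<in> L)"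

definition sieve :: "'a rel \<Rightarrow> 'a \<Rightarrow> 'a set \<Rightarrow> bool" where
  "sieve r c S \<longleftrightarrow> lower_set r S \<and> S \<subseteq> under r c"

text \<open>A Grothendieck topology is the set of pairs \<open>(c, S)\<close> such that \<open>S\<close> is a covering sieve
  on \<open>c\<close>. The pullback of \<open>S\<close> along \<open>d \<le> c\<close> is \<open>S \<inter> under r d\<close>.\<close>

definition grothendieck_topology :: "'a rel \<Rightarrow> ('a \<times> 'a set) set \<Rightarrow> bool" where
  "grothendieck_topology r J \<longleftrightarrow>
     (\<forall>(c, S)\<in>J. c \<in> Field r \<and> sieve r c S) \<and>
     (\<forall>c\<in>Field r. (c, under r c) \<in> J) \<and>
     (\<forall>c S d. (c, S) \<in> J \<and> (d, c) \<in> r \<longrightarrow> (d, S \<inter> under r d) \<in> J) \<and>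
     (\<forall>c S R. (c, S) \<in> J \<and> sieve r c R \<and> (\<forall>d\<in>S. (d, R \<inter> under r d) \<in> J) \<longrightarrow> (c, R) \<in> J)"

record 'a psite =
  leq :: "'a rel"
  cov :: "('a \<times> 'a set) set"

definition preorder_site :: "'a psite \<Rightarrow> bool" where
  "preorder_site X \<longleftrightarrow> Preorder (leq X) \<and> grothendieck_topology (leq X) (cov X)"

abbreviation elems :: "'a psite \<Rightarrow> 'a set" where
  "elems X \<equiv> Field (leq X)"

definition monotone_map :: "'a psite \<Rightarrow> 'a psite \<Rightarrow> ('a \<Rightarrow> 'a) \<Rightarrow> bool" where
  "monotone_map X Y f \<longleftrightarrow>
     f \<in> elems X \<rightarrow> elems Y \<and>
     monotone_on (elems X) (\<lambda>x y. (x, y) \<in> leq X) (\<lambda>x y. (x, y) \<in> leq Y) f"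

definition flat_map :: "'a psite \<Rightarrow> 'a psite \<Rightarrow> ('a \<Rightarrow> 'a) \<Rightarrow> bool" where
  "flat_map X Y f \<longleftrightarrow>
     (\<forall>d\<in>elems Y. \<exists>c\<in>elems X. (d, f c) \<in> leq Y) \<and>
     (\<forall>d\<in>elems Y. \<forall>c\<in>elems X. \<forall>c'\<in>elems X. (d, f c) \<in> leq Y \<and> (d, f c') \<in> leq Y \<longrightarrow>
        (\<exists>c''\<in>elems X. (c'', c) \<in> leq X \<and> (c'', c') \<in> leq X \<and> (d, f c'') \<in> leq Y))"

definition cover_preserving :: "'a psite \<Rightarrow> 'a psite \<Rightarrow> ('a \<Rightarrow> 'a) \<Rightarrow> bool" where
  "cover_preserving X Y f \<longleftrightarrow>
     (\<forall>(c, S)\<in>cov X. (f c, {d. \<exists>x\<in>S. (d, f x) \<in> leq Y}) \<in> cov Y)"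

definition site_morphism :: "'a psite \<Rightarrow> 'a psite \<Rightarrow> ('a \<Rightarrow> 'a) \<Rightarrow> bool" where
  "site_morphism X Y f \<longleftrightarrow> monotone_map X Y f \<and> flat_map X Y f \<and> cover_preserving X Y f"

definition subcanonical :: "'a psite \<Rightarrow> bool" where
  "subcanonical X \<longleftrightarrow>
     (\<forall>(c, S)\<in>cov X. least (gorder_of (leq X)) c (Upper (gorder_of (leq X)) S))"

text \<open>All preorders with a Grothendieck topology (with elements in a fixed type) and all
  monotone maps between them.\<close>

definition PreTop :: "('a psite, ('a psite, 'a) arrow) cat" where
  "PreTop = concrete_cat elems {X. preorder_site X} monotone_map"


section \<open>The locale of ideals\<close>

definition J_ideals :: "'a psite \<Rightarrow> 'a set set" where
  "J_ideals X = {I. lower_set (leq X) I \<and> (\<forall>(c, S)\<in>cov X. S \<subseteq> I \<longrightarrow> c \<in> I)}"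

definition ideal_locale :: "'a psite \<Rightarrow> 'a set rel" where
  "ideal_locale X = {(I, I'). I \<in> J_ideals X \<and> I' \<in> J_ideals X \<and> I \<subseteq> I'}"

text \<open>For \<open>T \<subseteq> elems X\<close> this intersection of ideals is itself an ideal, the smallest one
  containing \<open>T\<close>.\<close>

definition ideal_generated :: "'a psite \<Rightarrow> 'a set \<Rightarrow> 'a set" where
  "ideal_generated X T = (\<lambda>I. I \<in> J_ideals X) hull T"

text \<open>The arrow of \<open>Loc\<close> is represented by its frame homomorphism, which goes in the direction
  of \<open>f\<close>; its domain in \<open>Loc\<close> is thus \<open>ideal_locale Y\<close>.\<close>

fun ideal_locale_map :: "('a psite, 'a) arrow \<Rightarrow> ('a set rel, 'a set) arrow" where
  "ideal_locale_map (X, Y, f) =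
     (ideal_locale X, ideal_locale Y, \<lambda>I\<in>J_ideals X. ideal_generated Y (f ` I))"

end

theory Submission
  imports Defs
begin

text \<open>A subcanonical site can be read off from its set of ideals alone. Its elements are those
  lying in some ideal. Every principal lower set is an ideal, by subcanonicity, so
  \<open>c \<le> d\<close> holds iff every ideal containing \<open>d\<close> contains \<open>c\<close>. Finally, the ideal generated by a
  lower set \<open>L\<close> consists of the elements \<open>d\<close> that are covered by \<open>L \<inter> under d\<close>
  (\<open>ideal_generated_lower_set\<close>), so a sieve on \<open>c\<close> is covering iff every ideal containing it
  contains \<open>c\<close>. Hence \<open>ideal_locale\<close> is injective on subcanonical sites
  (\<open>ideal_locale_inj\<close>). It is also faithful on posets: the homomorphism induced by \<open>f\<close> sends
  the principal ideal of \<open>c\<close> to that of \<open>f c\<close>, which determines \<open>f c\<close> by antisymmetry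
  (\<open>ideal_locale_map_inj\<close>). A functor that is injective on objects and on arrows is an isomorphism
  onto its image, and injectivity on objects already makes the image closed under composition
  (\<open>image_cat_subcategory\<close>, \<open>image_cat_isomorphism\<close>).

  What remains is functoriality. The description of generated ideals shows that generating an
  ideal commutes with binary intersections of lower sets; this gives the frame law, and together
  with flatness the preservation of binary meets. Preservation of suprema and of composites both
  come from the fact that a cover-preserving monotone map pulls ideals back to ideals
  (\<open>vimage_J_ideal\<close>, \<open>ideal_generated_image\<close>).\<close>


section \<open>Functors that are injective on objects and arrows\<close>

text \<open>If \<open>Fm g\<close> and \<open>Fm f\<close> are composable, then so are \<open>g\<close> and \<open>f\<close>, because
  \<open>Fo (Cod f) = Fo (Dom g)\<close> and \<open>Fo\<close> is injective.\<close>

lemma image_cat_composable: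
  assumes F: "is_functor C D Fo Fm" and inj: "inj_on Fo (Obj C)"
    and fg: "f \<in> Arr C" "g \<in> Arr C" "Cod D (Fm f) = Dom D (Fm g)"
  shows "Cod C f = Dom C g" "Comp D (Fm g) (Fm f) = Fm (Comp C g f)" "Comp C g f \<in> Arr C"
proof -
  have C: "category C" using F by (simp add: is_functor_def)
  have "Fo (Cod C f) = Fo (Dom C g)" using F fg by (simp add: is_functor_def)
  then show eq: "Cod C f = Dom C g"
    using inj category.cod_closed[OF C fg(1)] category.dom_closed[OF C fg(2)]
    by (blast dest: inj_onD)
  show "Comp D (Fm g) (Fm f) = Fm (Comp C g f)" using F fg eq by (simp add: is_functor_def)
  show "Comp C g f \<in> Arr C" using category.comp_closed[OF C fg(1,2) eq] .
qed

lemma image_cat_subcategory: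
  assumes F: "is_functor C D Fo Fm" and inj: "inj_on Fo (Obj C)"
  shows "subcategory (image_cat C D Fo Fm) D"
proof -
  have C: "category C" and D: "category D" using F by (simp_all add: is_functor_def)
  have obj: "Fo X \<in> Obj D" if "X \<in> Obj C" for X using F that by (simp add: is_functor_def)
  have arr: "Fm f \<in> Arr D" "Dom D (Fm f) = Fo (Dom C f)" "Cod D (Fm f) = Fo (Cod C f)"
    if "f \<in> Arr C" for f using F that by (simp_all add: is_functor_def)
  have ide: "Ident D (Fo X) = Fm (Ident C X)" if "X \<in> Obj C" for X
    using F that by (simp add: is_functor_def)
  have "category (image_cat C D Fo Fm)"
  proof
    fix f assume "f \<in> Arr (image_cat C D Fo Fm)"
    then obtain f' where f': "f' \<in> Arr C" "f = Fm f'" by (auto simp: image_cat_def)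
    show "Dom (image_cat C D Fo Fm) f \<in> Obj (image_cat C D Fo Fm)"
      "Cod (image_cat C D Fo Fm) f \<in> Obj (image_cat C D Fo Fm)"
      using f' arr category.dom_closed[OF C] category.cod_closed[OF C]
      by (auto simp: image_cat_def)
    show "Comp (image_cat C D Fo Fm) f (Ident (image_cat C D Fo Fm) (Dom (image_cat C D Fo Fm) f)) = f"
      "Comp (image_cat C D Fo Fm) (Ident (image_cat C D Fo Fm) (Cod (image_cat C D Fo Fm) f)) f = f"
      using category.comp_ident_right[OF D arr(1)[OF f'(1)]]
        category.comp_ident_left[OF D arr(1)[OF f'(1)]] f'
      by (simp_all add: image_cat_def)
  next
    fix X assume "X \<in> Obj (image_cat C D Fo Fm)"
    then obtain X' where X': "X' \<in> Obj C" "X = Fo X'" by (auto simp: image_cat_def)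
    show "Ident (image_cat C D Fo Fm) X \<in> Arr (image_cat C D Fo Fm)"
      using X' ide category.ident_closed[OF C] by (auto simp: image_cat_def)
    show "Dom (image_cat C D Fo Fm) (Ident (image_cat C D Fo Fm) X) = X"
      "Cod (image_cat C D Fo Fm) (Ident (image_cat C D Fo Fm) X) = X"
      using X' obj category.dom_ident[OF D] category.cod_ident[OF D] by (auto simp: image_cat_def)
  next
    fix f g
    assume fg: "f \<in> Arr (image_cat C D Fo Fm)" "g \<in> Arr (image_cat C D Fo Fm)"
      "Cod (image_cat C D Fo Fm) f = Dom (image_cat C D Fo Fm) g"
    show "Comp (image_cat C D Fo Fm) g f \<in> Arr (image_cat C D Fo Fm)"
      using fg image_cat_composable[OF F inj] by (auto simp: image_cat_def)
    show "Dom (image_cat C D Fo Fm) (Comp (image_cat C D Fo Fm) g f) = Dom (image_cat C D Fo Fm) f"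
      "Cod (image_cat C D Fo Fm) (Comp (image_cat C D Fo Fm) g f) = Cod (image_cat C D Fo Fm) g"
      using fg arr category.dom_comp[OF D] category.cod_comp[OF D] by (auto simp: image_cat_def)
  next
    fix f g h
    assume "f \<in> Arr (image_cat C D Fo Fm)" "g \<in> Arr (image_cat C D Fo Fm)"
      "h \<in> Arr (image_cat C D Fo Fm)"
      "Cod (image_cat C D Fo Fm) f = Dom (image_cat C D Fo Fm) g"
      "Cod (image_cat C D Fo Fm) g = Dom (image_cat C D Fo Fm) h"
    then show "Comp (image_cat C D Fo Fm) h (Comp (image_cat C D Fo Fm) g f)
        = Comp (image_cat C D Fo Fm) (Comp (image_cat C D Fo Fm) h g) f"
      using arr category.comp_assoc[OF D] by (auto simp: image_cat_def)
  qed
  then show ?thesis using D obj arr by (auto simp: subcategory_def image_cat_def)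
qed

lemma image_cat_isomorphism:
  assumes F: "is_functor C D Fo Fm"
    and injo: "inj_on Fo (Obj C)" and injm: "inj_on Fm (Arr C)"
  shows "is_cat_isomorphism C (image_cat C D Fo Fm) Fo Fm"
proof -
  have C: "category C" using F by (simp add: is_functor_def)
  have I: "category (image_cat C D Fo Fm)"
    using image_cat_subcategory[OF F injo] by (simp add: subcategory_def)
  have F': "is_functor C (image_cat C D Fo Fm) Fo Fm"
    using F I by (simp add: is_functor_def image_cat_def)
  define Go where "Go = inv_into (Obj C) Fo"
  define Gm where "Gm = inv_into (Arr C) Fm"
  have Go: "Go (Fo X) = X" if "X \<in> Obj C" for X
    using that injo by (simp add: Go_def)
  have Gm: "Gm (Fm f) = f" if "f \<in> Arr C" for f
    using that injm by (simp add: Gm_def)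
  have G: "is_functor (image_cat C D Fo Fm) C Go Gm"
    unfolding is_functor_def
  proof (intro conjI ballI impI)
    fix Y assume "Y \<in> Obj (image_cat C D Fo Fm)"
    then obtain X where X: "X \<in> Obj C" "Y = Fo X" by (auto simp: image_cat_def)
    show "Go Y \<in> Obj C" using X Go by simp
    have "Fm (Ident C X) = Ident D (Fo X)" using F X by (simp add: is_functor_def)
    then show "Gm (Ident (image_cat C D Fo Fm) Y) = Ident C (Go Y)"
      using X Go Gm[OF category.ident_closed[OF C X(1)]] by (simp add: image_cat_def)
  next
    fix h assume "h \<in> Arr (image_cat C D Fo Fm)"
    then obtain f where f: "f \<in> Arr C" "h = Fm f" by (auto simp: image_cat_def)
    show "Gm h \<in> Arr C" using f Gm by simp
    show "Dom C (Gm h) = Go (Dom (image_cat C D Fo Fm) h)"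
      "Cod C (Gm h) = Go (Cod (image_cat C D Fo Fm) h)"
      using f Gm Go[OF category.dom_closed[OF C f(1)]] Go[OF category.cod_closed[OF C f(1)]] F
      by (simp_all add: image_cat_def is_functor_def)
    fix k assume k: "k \<in> Arr (image_cat C D Fo Fm)"
      and hk: "Cod (image_cat C D Fo Fm) h = Dom (image_cat C D Fo Fm) k"
    then obtain g where g: "g \<in> Arr C" "k = Fm g" by (auto simp: image_cat_def)
    have "Cod D (Fm f) = Dom D (Fm g)" using hk f g by (simp add: image_cat_def)
    from image_cat_composable[OF F injo f(1) g(1) this]
    show "Gm (Comp (image_cat C D Fo Fm) k h) = Comp C (Gm k) (Gm h)"
      using f g Gm by (simp add: image_cat_def)
  qed (use C I in auto)
  show ?thesis
    unfolding is_cat_isomorphism_def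
    using F' G Go Gm by (intro conjI exI[of _ Go] exI[of _ Gm]) (auto simp: image_cat_def)
qed

lemma op_category:
  assumes "category C"
  shows "category (op_cat C)"
proof -
  interpret category C by fact
  show ?thesis
    by unfold_locales
      (auto simp: op_cat_def dom_closed cod_closed ident_closed dom_ident cod_ident comp_closed
        dom_comp cod_comp comp_ident_left comp_ident_right comp_assoc)
qed


section \<open>The category of frames\<close>

lemma gorder_of_sel [simp]:
  "carrier (gorder_of r) = Field r"
  "x \<sqsubseteq>\<^bsub>gorder_of r\<^esub> y \<longleftrightarrow> (x, y) \<in> r"
  "(.=\<^bsub>gorder_of r\<^esub>) = (=)"
  by (simp_all add: gorder_of_def)

lemma concrete_category:
  assumes "\<And>X. X \<in> Ob \<Longrightarrow> Hom X X (\<lambda>x\<in>U X. x)"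
    and "\<And>X Y Z f g. \<lbrakk>X \<in> Ob; Y \<in> Ob; Z \<in> Ob; f \<in> U X \<rightarrow>\<^sub>E U Y; g \<in> U Y \<rightarrow>\<^sub>E U Z; Hom X Y f; Hom Y Z g\<rbrakk>
      \<Longrightarrow> Hom X Z (compose (U X) g f)"
  shows "category (concrete_cat U Ob Hom)"
proof -
  have ident: "(\<lambda>x\<in>U X. x) \<in> U X \<rightarrow>\<^sub>E U X" for X by simp
  have comp: "compose (U X) g f \<in> U X \<rightarrow>\<^sub>E U Z" if "f \<in> U X \<rightarrow>\<^sub>E U Y" "g \<in> U Y \<rightarrow>\<^sub>E U Z" for X Y Z f g
    using that by (auto simp: compose_def PiE_iff)
  have left: "compose (U X) (\<lambda>y\<in>U Y. y) f = f" and right: "compose (U X) f (\<lambda>x\<in>U X. x) = f"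
    if "f \<in> U X \<rightarrow>\<^sub>E U Y" for X Y f
    using that by (auto simp: PiE_def Id_compose compose_Id)
  have assoc: "compose (U X) h (compose (U X) g f) = compose (U X) (compose (U Y) h g) f"
    if "f \<in> U X \<rightarrow>\<^sub>E U Y" for X Y f g h
    using that by (auto simp: PiE_def intro: compose_assoc)
  \<comment> \<open>\<open>PiE_I\<close> would reduce membership of a composite to its values before \<open>comp\<close> applies.\<close>
  show ?thesis
    unfolding concrete_cat_def
    by unfold_locales (auto simp only: cat.simps split_conv mem_Collect_eq prod.inject assms(1)
        ident left right intro: assms(2) comp assoc del: PiE_I)
qed

lemma frame_hom_compose:
  assumes r: "frame r"
    and h: "frame_hom r s h" and k: "frame_hom s t k"
  shows "frame_hom r t (compose (Field r) k h)"
proof -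
  interpret R: complete_lattice "gorder_of r" using r by (simp add: frame_def)
  have hF: "h \<in> Field r \<rightarrow> Field s" and kF: "k \<in> Field s \<rightarrow> Field t"
    using h k by (simp_all add: frame_hom_def)
  have "compose (Field r) k h ` A = k ` h ` A" if "A \<subseteq> Field r" for A
    using that by (force simp: compose_def)
  moreover have "h ` A \<subseteq> Field s" if "A \<subseteq> Field r" for A using that hF by auto
  moreover have "\<Squnion>\<^bsub>gorder_of r\<^esub> A \<in> Field r" if "A \<subseteq> Field r" for A
    using that R.sup_closed[of A] by simp
  moreover have "a \<sqinter>\<^bsub>gorder_of r\<^esub> b \<in> Field r" if "a \<in> Field r" "b \<in> Field r" for a b
    using that R.meet_closed[of a b] by simp
  moreover have "\<top>\<^bsub>gorder_of r\<^esub> \<in> Field r" using R.top_closed by simp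
  ultimately show ?thesis
    using h k hF kF unfolding frame_hom_def by (simp add: compose_eq Pi_iff)
qed

lemma frame_hom_id:
  assumes "frame r"
  shows "frame_hom r r (\<lambda>x\<in>Field r. x)"
proof -
  interpret R: complete_lattice "gorder_of r" using assms by (simp add: frame_def)
  have "(\<lambda>x\<in>Field r. x) ` A = A" if "A \<subseteq> Field r" for A
    using that by force
  moreover have "\<Squnion>\<^bsub>gorder_of r\<^esub> A \<in> Field r" if "A \<subseteq> Field r" for A
    using that R.sup_closed[of A] by simp
  moreover have "a \<sqinter>\<^bsub>gorder_of r\<^esub> b \<in> Field r" if "a \<in> Field r" "b \<in> Field r" for a b
    using that R.meet_closed[of a b] by simp
  moreover have "\<top>\<^bsub>gorder_of r\<^esub> \<in> Field r" using R.top_closed by simp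
  ultimately show ?thesis unfolding frame_hom_def by simp
qed

lemma Loc_category: "category Loc"
  unfolding Loc_def Frm_def
  by (intro op_category concrete_category) (auto intro: frame_hom_compose frame_hom_id)


section \<open>Ideals of a preorder site\<close>

lemma preorder_siteD:
  assumes "preorder_site X"
  shows preorder_site_refl: "c \<in> elems X \<Longrightarrow> (c, c) \<in> leq X"
    and preorder_site_trans: "(c, d) \<in> leq X \<Longrightarrow> (d, e) \<in> leq X \<Longrightarrow> (c, e) \<in> leq X"
    and cov_elems: "(c, S) \<in> cov X \<Longrightarrow> c \<in> elems X"
    and cov_sieve: "(c, S) \<in> cov X \<Longrightarrow> sieve (leq X) c S"
    and cov_maximal: "c \<in> elems X \<Longrightarrow> (c, under (leq X) c) \<in> cov X"
    and cov_pullback: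
      "(c, S) \<in> cov X \<Longrightarrow> (d, c) \<in> leq X \<Longrightarrow> (d, S \<inter> under (leq X) d) \<in> cov X"
    and cov_local:
      "(c, S) \<in> cov X \<Longrightarrow> sieve (leq X) c R
        \<Longrightarrow> (\<And>d. d \<in> S \<Longrightarrow> (d, R \<inter> under (leq X) d) \<in> cov X) \<Longrightarrow> (c, R) \<in> cov X"
proof -
  have P: "Preorder (leq X)" and G: "grothendieck_topology (leq X) (cov X)"
    using assms by (auto simp: preorder_site_def)
  show "c \<in> elems X \<Longrightarrow> (c, c) \<in> leq X"
    "(c, d) \<in> leq X \<Longrightarrow> (d, e) \<in> leq X \<Longrightarrow> (c, e) \<in> leq X"
    using P by (auto simp: preorder_on_def refl_on_def trans_def)
  have sv: "\<forall>(c, S)\<in>cov X. c \<in> elems X \<and> sieve (leq X) c S"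
    and mx: "\<forall>c\<in>elems X. (c, under (leq X) c) \<in> cov X"
    and pb: "\<forall>c S d. (c, S) \<in> cov X \<and> (d, c) \<in> leq X \<longrightarrow> (d, S \<inter> under (leq X) d) \<in> cov X"
    and lc: "\<forall>c S R. (c, S) \<in> cov X \<and> sieve (leq X) c R \<and>
      (\<forall>d\<in>S. (d, R \<inter> under (leq X) d) \<in> cov X) \<longrightarrow> (c, R) \<in> cov X"
    using G unfolding grothendieck_topology_def by blast+
  show "(c, S) \<in> cov X \<Longrightarrow> c \<in> elems X" "(c, S) \<in> cov X \<Longrightarrow> sieve (leq X) c S"
    using sv by auto
  show "c \<in> elems X \<Longrightarrow> (c, under (leq X) c) \<in> cov X" using mx by blast
  show "(c, S) \<in> cov X \<Longrightarrow> (d, c) \<in> leq X \<Longrightarrow> (d, S \<inter> under (leq X) d) \<in> cov X" using pb by blast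
  show "(c, S) \<in> cov X \<Longrightarrow> sieve (leq X) c R
        \<Longrightarrow> (\<And>d. d \<in> S \<Longrightarrow> (d, R \<inter> under (leq X) d) \<in> cov X) \<Longrightarrow> (c, R) \<in> cov X"
    using lc by blast
qed

lemma under_subset:
  assumes "preorder_site X" "(d, c) \<in> leq X"
  shows "under (leq X) d \<subseteq> under (leq X) c"
  using preorder_site_trans[OF assms(1) _ assms(2)] by (auto simp: under_def)

lemma sieve_Int_under:
  assumes "preorder_site X" "lower_set (leq X) L"
  shows "sieve (leq X) c (L \<inter> under (leq X) c)"
  unfolding sieve_def lower_set_def
proof (intro conjI ballI allI impI)
  show "L \<inter> under (leq X) c \<subseteq> elems X" using assms(2) by (auto simp: lower_set_def)
  fix d e assume d: "d \<in> L \<inter> under (leq X) c" and e: "(e, d) \<in> leq X"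
  then have "(e, c) \<in> leq X" using preorder_site_trans[OF assms(1) e] by (simp add: under_def)
  then show "e \<in> L \<inter> under (leq X) c" using d e assms(2) by (auto simp: lower_set_def under_def)
qed simp

lemma J_idealsI:
  assumes "I \<subseteq> elems X"
    and "\<And>c d. c \<in> I \<Longrightarrow> (d, c) \<in> leq X \<Longrightarrow> d \<in> I"
    and "\<And>c S. (c, S) \<in> cov X \<Longrightarrow> S \<subseteq> I \<Longrightarrow> c \<in> I"
  shows "I \<in> J_ideals X"
  using assms by (auto simp: J_ideals_def lower_set_def)

lemma J_ideals_lower_set: "I \<in> J_ideals X \<Longrightarrow> lower_set (leq X) I"
  by (simp add: J_ideals_def)

lemma J_ideals_subset: "I \<in> J_ideals X \<Longrightarrow> I \<subseteq> elems X"
  by (simp add: J_ideals_def lower_set_def)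

lemma J_ideals_down: "I \<in> J_ideals X \<Longrightarrow> c \<in> I \<Longrightarrow> (d, c) \<in> leq X \<Longrightarrow> d \<in> I"
  by (auto simp: J_ideals_def lower_set_def)

lemma J_ideals_cov: "I \<in> J_ideals X \<Longrightarrow> (c, S) \<in> cov X \<Longrightarrow> S \<subseteq> I \<Longrightarrow> c \<in> I"
  by (auto simp: J_ideals_def)

lemma elems_J_ideal:
  assumes "preorder_site X"
  shows "elems X \<in> J_ideals X"
  by (rule J_idealsI) (auto intro: FieldI1 cov_elems[OF assms])

text \<open>For \<open>A = {}\<close> the infimum is the largest ideal \<open>elems X\<close>, whereas \<open>\<Inter>{} = UNIV\<close>.\<close>

lemma Inter_J_ideal:
  assumes X: "preorder_site X" and A: "A \<subseteq> J_ideals X"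
  shows "elems X \<inter> \<Inter>A \<in> J_ideals X"
proof (rule J_idealsI)
  fix c d assume c: "c \<in> elems X \<inter> \<Inter>A" and d: "(d, c) \<in> leq X"
  have "d \<in> I" if "I \<in> A" for I
    using J_ideals_down[OF subsetD[OF A that] _ d] c that by blast
  then show "d \<in> elems X \<inter> \<Inter>A" using FieldI1[OF d] by simp
next
  fix c S assume c: "(c, S) \<in> cov X" and S: "S \<subseteq> elems X \<inter> \<Inter>A"
  have "c \<in> I" if "I \<in> A" for I
    using J_ideals_cov[OF subsetD[OF A that] c] S that by blast
  then show "c \<in> elems X \<inter> \<Inter>A" using cov_elems[OF X c] by simp
qed simp

lemma Int_J_ideal:
  assumes I: "I \<in> J_ideals X" and I': "I' \<in> J_ideals X"
  shows "I \<inter> I' \<in> J_ideals X"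
  by (rule J_idealsI)
    (use J_ideals_subset[OF I] in \<open>auto intro: J_ideals_down[OF I] J_ideals_down[OF I']
      J_ideals_cov[OF I] J_ideals_cov[OF I']\<close>)

lemma ideal_generated_eq_Inter: "ideal_generated X T = \<Inter>{I \<in> J_ideals X. T \<subseteq> I}"
  by (simp add: ideal_generated_def hull_def)

lemma ideal_generated_J_ideal:
  assumes "preorder_site X" "T \<subseteq> elems X"
  shows "ideal_generated X T \<in> J_ideals X"
proof -
  have "ideal_generated X T = elems X \<inter> \<Inter>{I \<in> J_ideals X. T \<subseteq> I}"
    using elems_J_ideal[OF assms(1)] assms(2) by (auto simp: ideal_generated_eq_Inter)
  then show ?thesis using Inter_J_ideal[OF assms(1), of "{I \<in> J_ideals X. T \<subseteq> I}"] by auto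
qed

lemma ideal_generated_superset: "T \<subseteq> ideal_generated X T"
  by (auto simp: ideal_generated_eq_Inter)

lemma ideal_generated_subset_iff:
  "I \<in> J_ideals X \<Longrightarrow> ideal_generated X T \<subseteq> I \<longleftrightarrow> T \<subseteq> I"
  unfolding ideal_generated_def by (rule subset_hull)

lemma ideal_generated_same: "I \<in> J_ideals X \<Longrightarrow> ideal_generated X I = I"
  unfolding ideal_generated_def by (rule hull_same)

lemma ideal_generated_mono: "T \<subseteq> T' \<Longrightarrow> ideal_generated X T \<subseteq> ideal_generated X T'"
  unfolding ideal_generated_def by (rule hull_mono)

text \<open>The elements covered by \<open>L\<close> already form an ideal: by the local character of the topology,
  an element covered by such elements is itself covered by \<open>L\<close>. So one step of adding covered
  elements suffices.\<close>

lemma ideal_generated_lower_set: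
  assumes X: "preorder_site X" and L: "lower_set (leq X) L"
  shows "ideal_generated X L = {d. (d, L \<inter> under (leq X) d) \<in> cov X}" (is "_ = ?M")
proof
  have res: "L \<inter> under (leq X) c \<inter> under (leq X) d = L \<inter> under (leq X) d"
    if "(d, c) \<in> leq X" for c d
    using under_subset[OF X that] by blast
  have "?M \<in> J_ideals X"
  proof (rule J_idealsI)
    show "?M \<subseteq> elems X" using cov_elems[OF X] by blast
  next
    fix c d assume "c \<in> ?M" and dc: "(d, c) \<in> leq X"
    then show "d \<in> ?M" using cov_pullback[OF X _ dc, of "L \<inter> under (leq X) c"] res[OF dc] by simp
  next
    fix c S assume c: "(c, S) \<in> cov X" "S \<subseteq> ?M"
    have "(c, L \<inter> under (leq X) c) \<in> cov X"
    proof (rule cov_local[OF X c(1)])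
      show "sieve (leq X) c (L \<inter> under (leq X) c)" by (rule sieve_Int_under[OF X L])
      fix d assume "d \<in> S"
      then have "(d, c) \<in> leq X" "d \<in> ?M"
        using cov_sieve[OF X c(1)] c(2) by (auto simp: sieve_def under_def)
      then show "(d, L \<inter> under (leq X) c \<inter> under (leq X) d) \<in> cov X" using res by simp
    qed
    then show "c \<in> ?M" by simp
  qed
  moreover have "L \<subseteq> ?M"
  proof
    fix d assume d: "d \<in> L"
    then have "L \<inter> under (leq X) d = under (leq X) d"
      using L by (auto simp: lower_set_def under_def)
    then show "d \<in> ?M" using cov_maximal[OF X, of d] d L by (auto simp: lower_set_def)
  qed
  ultimately show "ideal_generated X L \<subseteq> ?M" by (simp add: ideal_generated_subset_iff)
  show "?M \<subseteq> ideal_generated X L"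
  proof
    fix d assume d: "d \<in> ?M"
    have "d \<in> I" if "I \<in> J_ideals X" "L \<subseteq> I" for I
      using J_ideals_cov[OF that(1)] d that(2) by auto
    then show "d \<in> ideal_generated X L" by (simp add: ideal_generated_eq_Inter)
  qed
qed

text \<open>The intersection of two covering sieves is covering, by local character and stability.\<close>

lemma ideal_generated_Int:
  assumes X: "preorder_site X" and L: "lower_set (leq X) L" "lower_set (leq X) L'"
  shows "ideal_generated X (L \<inter> L') = ideal_generated X L \<inter> ideal_generated X L'"
proof
  show "ideal_generated X (L \<inter> L') \<subseteq> ideal_generated X L \<inter> ideal_generated X L'"
    by (simp add: ideal_generated_mono)
  have LL: "lower_set (leq X) (L \<inter> L')" using L by (auto simp: lower_set_def)
  show "ideal_generated X L \<inter> ideal_generated X L' \<subseteq> ideal_generated X (L \<inter> L')"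
    unfolding ideal_generated_lower_set[OF X LL] ideal_generated_lower_set[OF X L(1)]
      ideal_generated_lower_set[OF X L(2)]
  proof clarify
    fix d assume d: "(d, L \<inter> under (leq X) d) \<in> cov X" "(d, L' \<inter> under (leq X) d) \<in> cov X"
    show "(d, L \<inter> L' \<inter> under (leq X) d) \<in> cov X"
    proof (rule cov_local[OF X d(1)])
      show "sieve (leq X) d (L \<inter> L' \<inter> under (leq X) d)" by (rule sieve_Int_under[OF X LL])
      fix e assume e: "e \<in> L \<inter> under (leq X) d"
      then have "L \<inter> L' \<inter> under (leq X) d \<inter> under (leq X) e
          = L' \<inter> under (leq X) d \<inter> under (leq X) e"
        using L(1) by (auto simp: lower_set_def under_def)
      then show "(e, L \<inter> L' \<inter> under (leq X) d \<inter> under (leq X) e) \<in> cov X"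
        using cov_pullback[OF X d(2), of e] e by (simp add: under_def)
    qed
  qed
qed

lemma ideal_generated_Union:
  assumes X: "preorder_site X" and T: "\<And>i. i \<in> A \<Longrightarrow> T i \<subseteq> elems X"
  shows "ideal_generated X (\<Union>i\<in>A. ideal_generated X (T i)) = ideal_generated X (\<Union>i\<in>A. T i)"
proof
  have "ideal_generated X (\<Union>i\<in>A. T i) \<in> J_ideals X"
    by (rule ideal_generated_J_ideal[OF X]) (use T in auto)
  moreover have "ideal_generated X (T i) \<subseteq> ideal_generated X (\<Union>i\<in>A. T i)" if "i \<in> A" for i
    by (rule ideal_generated_mono) (use that in auto)
  ultimately show "ideal_generated X (\<Union>i\<in>A. ideal_generated X (T i))
      \<subseteq> ideal_generated X (\<Union>i\<in>A. T i)"
    by (subst ideal_generated_subset_iff) auto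
  show "ideal_generated X (\<Union>i\<in>A. T i)
      \<subseteq> ideal_generated X (\<Union>i\<in>A. ideal_generated X (T i))"
    by (intro ideal_generated_mono UN_mono ideal_generated_superset subset_refl)
qed


section \<open>The frame of ideals\<close>

lemma Field_ideal_locale [simp]: "Field (ideal_locale X) = J_ideals X"
  by (auto simp: ideal_locale_def Field_def)

lemma ideal_locale_iff: "(I, I') \<in> ideal_locale X \<longleftrightarrow> I \<in> J_ideals X \<and> I' \<in> J_ideals X \<and> I \<subseteq> I'"
  by (simp add: ideal_locale_def)

lemma ideal_locale_least_Upper:
  assumes "preorder_site X" "A \<subseteq> J_ideals X"
  shows "least (gorder_of (ideal_locale X)) (ideal_generated X (\<Union>A))
    (Upper (gorder_of (ideal_locale X)) A)"
proof -
  have g: "ideal_generated X (\<Union>A) \<in> J_ideals X"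
    by (rule ideal_generated_J_ideal[OF assms(1)]) (use assms(2) J_ideals_subset in blast)
  then show ?thesis
    using assms(2) ideal_generated_superset[of "\<Union>A" X]
    by (auto simp: least_def Upper_def ideal_locale_iff ideal_generated_subset_iff
        dest: subsetD intro!: Union_least)
qed

lemma ideal_locale_greatest_Lower:
  assumes "preorder_site X" "A \<subseteq> J_ideals X"
  shows "greatest (gorder_of (ideal_locale X)) (elems X \<inter> \<Inter>A)
    (Lower (gorder_of (ideal_locale X)) A)"
  using Inter_J_ideal[OF assms] assms(2) J_ideals_subset
  by (auto simp: greatest_def Lower_def ideal_locale_iff)

lemma ideal_locale_complete_lattice:
  assumes "preorder_site X"
  shows "complete_lattice (gorder_of (ideal_locale X))"
proof -
  interpret partial_order "gorder_of (ideal_locale X)"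
    by unfold_locales (auto simp: ideal_locale_iff)
  show ?thesis
    by (rule complete_latticeI)
      (auto intro: ideal_locale_least_Upper[OF assms] ideal_locale_greatest_Lower[OF assms])
qed

lemma ideal_locale_sup:
  assumes "preorder_site X" "A \<subseteq> J_ideals X"
  shows "\<Squnion>\<^bsub>gorder_of (ideal_locale X)\<^esub> A = ideal_generated X (\<Union>A)"
proof -
  interpret complete_lattice "gorder_of (ideal_locale X)"
    by (rule ideal_locale_complete_lattice[OF assms(1)])
  show ?thesis
    unfolding sup_def
    using ideal_locale_least_Upper[OF assms]
    by (rule some_equality) (rule least_unique[OF _ ideal_locale_least_Upper[OF assms]])
qed

lemma ideal_locale_meet:
  assumes "preorder_site X" "I \<in> J_ideals X" "I' \<in> J_ideals X"
  shows "I \<sqinter>\<^bsub>gorder_of (ideal_locale X)\<^esub> I' = I \<inter> I'"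
proof -
  interpret complete_lattice "gorder_of (ideal_locale X)"
    by (rule ideal_locale_complete_lattice[OF assms(1)])
  have "elems X \<inter> \<Inter>{I, I'} = I \<inter> I'" using J_ideals_subset[OF assms(2)] by auto
  then have gr: "greatest (gorder_of (ideal_locale X)) (I \<inter> I')
      (Lower (gorder_of (ideal_locale X)) {I, I'})"
    using ideal_locale_greatest_Lower[OF assms(1), of "{I, I'}"] assms(2,3) by simp
  show ?thesis
    unfolding meet_def inf_def using gr
    by (rule some_equality) (rule greatest_unique[OF _ gr])
qed

lemma ideal_locale_top:
  assumes "preorder_site X"
  shows "\<top>\<^bsub>gorder_of (ideal_locale X)\<^esub> = elems X"
proof -
  interpret complete_lattice "gorder_of (ideal_locale X)"
    by (rule ideal_locale_complete_lattice[OF assms])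
  have gr: "greatest (gorder_of (ideal_locale X)) (elems X) (carrier (gorder_of (ideal_locale X)))"
    by (auto simp: greatest_def ideal_locale_iff elems_J_ideal[OF assms] dest: J_ideals_subset)
  show ?thesis
    unfolding top_def using gr by (rule some_equality) (rule greatest_unique[OF _ gr])
qed

text \<open>An ideal \<open>I\<close> is generated by itself, so the frame law is \<open>ideal_generated_Int\<close> applied to the
  lower sets \<open>I\<close> and \<open>\<Union>A\<close>.\<close>

lemma ideal_locale_frame:
  assumes X: "preorder_site X"
  shows "frame (ideal_locale X)"
  unfolding frame_def
proof (intro conjI ballI allI impI)
  show "complete_lattice (gorder_of (ideal_locale X))"
    by (rule ideal_locale_complete_lattice[OF X])
  fix I A assume "I \<in> Field (ideal_locale X)" "A \<subseteq> Field (ideal_locale X)"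
  then have I: "I \<in> J_ideals X" and A: "A \<subseteq> J_ideals X" by simp_all
  have lo: "lower_set (leq X) (\<Union>A)"
    using A by (auto simp: J_ideals_def lower_set_def)
  have sub: "\<Union>A \<subseteq> elems X" using lo by (simp add: lower_set_def)
  have "I \<inter> ideal_generated X (\<Union>A) = ideal_generated X (I \<inter> \<Union>A)"
    using ideal_generated_Int[OF X J_ideals_lower_set[OF I] lo] ideal_generated_same[OF I] by simp
  also have "I \<inter> \<Union>A = \<Union>((\<lambda>I'. I \<inter> I') ` A)" by auto
  finally have "I \<inter> ideal_generated X (\<Union>A) = ideal_generated X (\<Union>((\<lambda>I'. I \<inter> I') ` A))" .
  moreover have "(\<lambda>I'. I \<sqinter>\<^bsub>gorder_of (ideal_locale X)\<^esub> I') ` A = (\<lambda>I'. I \<inter> I') ` A"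
    using A ideal_locale_meet[OF X I] by (intro image_cong) auto
  moreover have "(\<lambda>I'. I \<inter> I') ` A \<subseteq> J_ideals X" using A Int_J_ideal[OF I] by blast
  ultimately show "I \<sqinter>\<^bsub>gorder_of (ideal_locale X)\<^esub> (\<Squnion>\<^bsub>gorder_of (ideal_locale X)\<^esub> A)
      = \<Squnion>\<^bsub>gorder_of (ideal_locale X)\<^esub> ((\<lambda>I'. I \<sqinter>\<^bsub>gorder_of (ideal_locale X)\<^esub> I') ` A)"
    using ideal_locale_sup[OF X] A ideal_locale_meet[OF X I]
      ideal_generated_J_ideal[OF X sub] by simp
qed


section \<open>The frame homomorphism induced by a morphism of sites\<close>

lemma monotone_mapD:
  assumes "monotone_map X Y f"
  shows monotone_map_elems: "c \<in> elems X \<Longrightarrow> f c \<in> elems Y"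
    and monotone_map_mono: "(c, c') \<in> leq X \<Longrightarrow> (f c, f c') \<in> leq Y"
  using assms by (auto simp: monotone_map_def monotone_on_def intro: FieldI1 FieldI2)

text \<open>The pullback \<open>f\<^sup>-\<^sup>1 I\<close> is an ideal: if \<open>S\<close> covers \<open>c\<close> and \<open>f\<close> maps \<open>S\<close> into \<open>I\<close>, then the
  sieve generated by \<open>f ` S\<close> lies in \<open>I\<close> and covers \<open>f c\<close>. This right adjoint to the
  induced frame homomorphism is what makes the homomorphism preserve suprema.\<close>

lemma vimage_J_ideal:
  assumes X: "preorder_site X" and f: "monotone_map X Y f" "cover_preserving X Y f"
    and I: "I \<in> J_ideals Y"
  shows "{c \<in> elems X. f c \<in> I} \<in> J_ideals X"
proof (rule J_idealsI)
  fix c S assume c: "(c, S) \<in> cov X" "S \<subseteq> {c \<in> elems X. f c \<in> I}"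
  have "(f c, {d. \<exists>x\<in>S. (d, f x) \<in> leq Y}) \<in> cov Y"
    using f(2) c(1) by (auto simp: cover_preserving_def)
  moreover have "{d. \<exists>x\<in>S. (d, f x) \<in> leq Y} \<subseteq> I" using c(2) J_ideals_down[OF I] by blast
  ultimately show "c \<in> {c \<in> elems X. f c \<in> I}"
    using J_ideals_cov[OF I] cov_elems[OF X c(1)] by blast
qed (auto intro: FieldI1 J_ideals_down[OF I] monotone_map_mono[OF f(1)])

lemma ideal_generated_image:
  assumes X: "preorder_site X" and Y: "preorder_site Y"
    and f: "monotone_map X Y f" "cover_preserving X Y f" and T: "T \<subseteq> elems X"
  shows "ideal_generated Y (f ` ideal_generated X T) = ideal_generated Y (f ` T)"
proof
  have fT: "ideal_generated Y (f ` T) \<in> J_ideals Y"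
    by (rule ideal_generated_J_ideal[OF Y]) (use T monotone_map_elems[OF f(1)] in auto)
  have "T \<subseteq> {c \<in> elems X. f c \<in> ideal_generated Y (f ` T)}"
    using T ideal_generated_superset[of "f ` T" Y] by auto
  then have "ideal_generated X T \<subseteq> {c \<in> elems X. f c \<in> ideal_generated Y (f ` T)}"
    using ideal_generated_subset_iff[OF vimage_J_ideal[OF X f fT]] by simp
  then show "ideal_generated Y (f ` ideal_generated X T) \<subseteq> ideal_generated Y (f ` T)"
    using ideal_generated_subset_iff[OF fT] by auto
  show "ideal_generated Y (f ` T) \<subseteq> ideal_generated Y (f ` ideal_generated X T)"
    by (intro ideal_generated_mono image_mono ideal_generated_superset)
qed

text \<open>Passing to lower sets makes the explicit description of generated ideals available.\<close>

lemma ideal_generated_down: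
  assumes Y: "preorder_site Y" and T: "T \<subseteq> elems Y"
  shows "ideal_generated Y T = ideal_generated Y {d. \<exists>x\<in>T. (d, x) \<in> leq Y}"
proof
  show "ideal_generated Y T \<subseteq> ideal_generated Y {d. \<exists>x\<in>T. (d, x) \<in> leq Y}"
    using T preorder_site_refl[OF Y] by (intro ideal_generated_mono) blast
  have I: "ideal_generated Y T \<in> J_ideals Y" by (rule ideal_generated_J_ideal[OF Y T])
  show "ideal_generated Y {d. \<exists>x\<in>T. (d, x) \<in> leq Y} \<subseteq> ideal_generated Y T"
    unfolding ideal_generated_subset_iff[OF I]
    using J_ideals_down[OF I] ideal_generated_superset[of T Y] by blast
qed

lemma down_lower_set:
  assumes "preorder_site Y"
  shows "lower_set (leq Y) {d. \<exists>x\<in>T. (d, x) \<in> leq Y}"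
  unfolding lower_set_def
  by (auto intro: FieldI1) (blast intro: preorder_site_trans[OF assms])

text \<open>Flatness gives the finite meets. By its first condition, \<open>f ` elems X\<close> generates \<open>elems Y\<close>;
  by the second one, the lower sets generated by \<open>f ` I\<close> and \<open>f ` I'\<close> intersect in the lower set
  generated by \<open>f ` (I \<inter> I')\<close>.\<close>

lemma site_morphism_frame_hom:
  assumes X: "preorder_site X" and Y: "preorder_site Y" and f: "site_morphism X Y f"
  shows "frame_hom (ideal_locale X) (ideal_locale Y) (\<lambda>I\<in>J_ideals X. ideal_generated Y (f ` I))"
    (is "frame_hom _ _ ?h")
proof -
  have mono: "monotone_map X Y f" and flat: "flat_map X Y f" and cp: "cover_preserving X Y f"
    using f by (simp_all add: site_morphism_def)
  have im: "f ` T \<subseteq> elems Y" if "T \<subseteq> elems X" for T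
    using that monotone_map_elems[OF mono] by auto
  have closed: "ideal_generated Y (f ` I) \<in> J_ideals Y" if "I \<in> J_ideals X" for I
    by (rule ideal_generated_J_ideal[OF Y im[OF J_ideals_subset[OF that]]])
  have top: "ideal_generated Y (f ` elems X) = elems Y"
  proof -
    have "{d. \<exists>x\<in>f ` elems X. (d, x) \<in> leq Y} = elems Y"
      using flat by (auto simp: flat_map_def intro: FieldI1)
    then show ?thesis
      using ideal_generated_down[OF Y im[OF subset_refl]] ideal_generated_same[OF elems_J_ideal[OF Y]]
      by simp
  qed
  have meet: "ideal_generated Y (f ` (I \<inter> I')) = ideal_generated Y (f ` I) \<inter> ideal_generated Y (f ` I')"
    if I: "I \<in> J_ideals X" and I': "I' \<in> J_ideals X" for I I'
  proof -
    let ?D = "\<lambda>I. {d. \<exists>x\<in>f ` I. (d, x) \<in> leq Y}"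
    have "?D I \<inter> ?D I' \<subseteq> ?D (I \<inter> I')"
    proof
      fix d assume "d \<in> ?D I \<inter> ?D I'"
      then obtain c c' where c: "c \<in> I" "(d, f c) \<in> leq Y" and c': "c' \<in> I'" "(d, f c') \<in> leq Y"
        by auto
      moreover have "d \<in> elems Y" "c \<in> elems X" "c' \<in> elems X"
        using c c' J_ideals_subset[OF I] J_ideals_subset[OF I'] by (auto intro: FieldI1)
      ultimately obtain c'' where "(c'', c) \<in> leq X" "(c'', c') \<in> leq X" "(d, f c'') \<in> leq Y"
        using flat unfolding flat_map_def by meson
      then show "d \<in> ?D (I \<inter> I')" using c(1) c'(1) J_ideals_down[OF I] J_ideals_down[OF I'] by blast
    qed
    then have D: "?D (I \<inter> I') = ?D I \<inter> ?D I'" by auto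
    have "ideal_generated Y (f ` (I \<inter> I')) = ideal_generated Y (?D (I \<inter> I'))"
      by (rule ideal_generated_down[OF Y im]) (use J_ideals_subset[OF I] in auto)
    also have "\<dots> = ideal_generated Y (?D I) \<inter> ideal_generated Y (?D I')"
      unfolding D by (rule ideal_generated_Int[OF Y down_lower_set[OF Y] down_lower_set[OF Y]])
    also have "\<dots> = ideal_generated Y (f ` I) \<inter> ideal_generated Y (f ` I')"
      using ideal_generated_down[OF Y im[OF J_ideals_subset[OF I]]]
        ideal_generated_down[OF Y im[OF J_ideals_subset[OF I']]] by simp
    finally show ?thesis .
  qed
  have sup: "?h (ideal_generated X (\<Union>A)) = ideal_generated Y (\<Union>(?h ` A))"
    if A: "A \<subseteq> J_ideals X" for A
  proof -
    have sub: "\<Union>A \<subseteq> elems X" using A J_ideals_subset by blast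
    have "?h (ideal_generated X (\<Union>A)) = ideal_generated Y (f ` (\<Union>A))"
      using ideal_generated_J_ideal[OF X sub] ideal_generated_image[OF X Y mono cp sub] by simp
    also have "f ` (\<Union>A) = (\<Union>I\<in>A. f ` I)" by auto
    also have "ideal_generated Y (\<Union>I\<in>A. f ` I)
        = ideal_generated Y (\<Union>I\<in>A. ideal_generated Y (f ` I))"
      by (rule ideal_generated_Union[OF Y, symmetric]) (use im A J_ideals_subset in blast)
    also have "(\<Union>I\<in>A. ideal_generated Y (f ` I)) = \<Union>(?h ` A)" using A by (intro SUP_cong) auto
    finally show ?thesis .
  qed
  show ?thesis
    unfolding frame_hom_def Field_ideal_locale
  proof (intro conjI ballI allI impI)
    show "?h \<in> J_ideals X \<rightarrow> J_ideals Y" using closed by auto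
    show "?h \<top>\<^bsub>gorder_of (ideal_locale X)\<^esub> = \<top>\<^bsub>gorder_of (ideal_locale Y)\<^esub>"
      by (simp add: ideal_locale_top X Y elems_J_ideal top)
  next
    fix I I' assume "I \<in> J_ideals X" "I' \<in> J_ideals X"
    then show "?h (I \<sqinter>\<^bsub>gorder_of (ideal_locale X)\<^esub> I')
        = ?h I \<sqinter>\<^bsub>gorder_of (ideal_locale Y)\<^esub> ?h I'"
      by (simp add: ideal_locale_meet X Y closed Int_J_ideal meet)
  next
    fix A assume A: "A \<subseteq> J_ideals X"
    then have "?h ` A \<subseteq> J_ideals Y" using closed by auto
    then show "?h (\<Squnion>\<^bsub>gorder_of (ideal_locale X)\<^esub> A) = \<Squnion>\<^bsub>gorder_of (ideal_locale Y)\<^esub> (?h ` A)"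
      by (simp only: ideal_locale_sup X Y A sup)
  qed
qed


section \<open>Recovering sites and maps from ideals\<close>

text \<open>If a sieve \<open>S\<close> below \<open>c\<close> covers \<open>d\<close>, then \<open>c\<close> is an upper bound of \<open>S\<close> and \<open>d\<close> is its
  supremum, so \<open>d \<le> c\<close>.\<close>

lemma under_J_ideal:
  assumes X: "preorder_site X" and sc: "subcanonical X" and c: "c \<in> elems X"
  shows "under (leq X) c \<in> J_ideals X"
proof (rule J_idealsI)
  fix d S assume d: "(d, S) \<in> cov X" "S \<subseteq> under (leq X) c"
  have "c \<in> Upper (gorder_of (leq X)) S" using c d(2) by (auto simp: Upper_def under_def)
  then show "d \<in> under (leq X) c" using sc d(1) by (auto simp: subcanonical_def least_def under_def)
qed (auto simp: under_def intro: FieldI1 preorder_site_trans[OF X])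

lemma elems_eq_Union_J_ideals:
  assumes "preorder_site X"
  shows "elems X = \<Union>(J_ideals X)"
  by (rule antisym) (simp_all add: Union_upper[OF elems_J_ideal[OF assms]] Union_least J_ideals_subset)

lemma leq_iff_J_ideals:
  assumes X: "preorder_site X" and sc: "subcanonical X"
  shows "(c, d) \<in> leq X \<longleftrightarrow> c \<in> elems X \<and> d \<in> elems X \<and> (\<forall>I\<in>J_ideals X. d \<in> I \<longrightarrow> c \<in> I)"
proof
  assume "(c, d) \<in> leq X"
  then show "c \<in> elems X \<and> d \<in> elems X \<and> (\<forall>I\<in>J_ideals X. d \<in> I \<longrightarrow> c \<in> I)"
    using J_ideals_down by (auto intro: FieldI1 FieldI2)
next
  assume a: "c \<in> elems X \<and> d \<in> elems X \<and> (\<forall>I\<in>J_ideals X. d \<in> I \<longrightarrow> c \<in> I)"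
  then have "d \<in> under (leq X) d" using preorder_site_refl[OF X] by (simp add: under_def)
  then have "c \<in> under (leq X) d" using a under_J_ideal[OF X sc] by blast
  then show "(c, d) \<in> leq X" by (simp add: under_def)
qed

lemma cov_iff_J_ideals:
  assumes X: "preorder_site X"
  shows "(c, S) \<in> cov X \<longleftrightarrow> sieve (leq X) c S \<and> (\<forall>I\<in>J_ideals X. S \<subseteq> I \<longrightarrow> c \<in> I)"
proof
  assume c: "(c, S) \<in> cov X"
  then show "sieve (leq X) c S \<and> (\<forall>I\<in>J_ideals X. S \<subseteq> I \<longrightarrow> c \<in> I)"
    using cov_sieve[OF X c] J_ideals_cov[OF _ c] by simp
next
  assume a: "sieve (leq X) c S \<and> (\<forall>I\<in>J_ideals X. S \<subseteq> I \<longrightarrow> c \<in> I)"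
  then have S: "lower_set (leq X) S" "S \<inter> under (leq X) c = S" by (auto simp: sieve_def)
  have "c \<in> ideal_generated X S" using a by (auto simp: ideal_generated_eq_Inter)
  then show "(c, S) \<in> cov X" using S by (simp add: ideal_generated_lower_set[OF X])
qed

lemma ideal_locale_inj:
  assumes X: "preorder_site X" "subcanonical X" and Y: "preorder_site Y" "subcanonical Y"
    and eq: "ideal_locale X = ideal_locale Y"
  shows "X = Y"
proof -
  have J: "J_ideals X = J_ideals Y" using eq by (metis Field_ideal_locale)
  have "elems X = elems Y" using J elems_eq_Union_J_ideals X(1) Y(1) by metis
  then have leq: "leq X = leq Y"
    using J leq_iff_J_ideals[OF X] leq_iff_J_ideals[OF Y] by auto
  have "cov X = cov Y"
    using J leq cov_iff_J_ideals[OF X(1)] cov_iff_J_ideals[OF Y(1)] by auto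
  then show ?thesis using leq by simp
qed

lemma ideal_generated_image_under:
  assumes X: "preorder_site X" and Y: "preorder_site Y" "subcanonical Y"
    and f: "monotone_map X Y f" and c: "c \<in> elems X"
  shows "ideal_generated Y (f ` under (leq X) c) = under (leq Y) (f c)"
proof
  have I: "under (leq Y) (f c) \<in> J_ideals Y"
    by (rule under_J_ideal[OF Y monotone_map_elems[OF f c]])
  have sub: "f ` under (leq X) c \<subseteq> under (leq Y) (f c)"
    using monotone_map_mono[OF f] by (auto simp: under_def)
  then show "ideal_generated Y (f ` under (leq X) c) \<subseteq> under (leq Y) (f c)"
    by (simp add: ideal_generated_subset_iff[OF I])
  have "f ` under (leq X) c \<subseteq> elems Y" using sub J_ideals_subset[OF I] by blast
  then have J: "ideal_generated Y (f ` under (leq X) c) \<in> J_ideals Y"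
    by (rule ideal_generated_J_ideal[OF Y(1)])
  have "f c \<in> ideal_generated Y (f ` under (leq X) c)"
    using ideal_generated_superset[of "f ` under (leq X) c" Y] preorder_site_refl[OF X c]
    by (auto simp: under_def)
  then show "under (leq Y) (f c) \<subseteq> ideal_generated Y (f ` under (leq X) c)"
    using J_ideals_down[OF J] by (auto simp: under_def)
qed

lemma ideal_locale_map_inj:
  assumes X: "preorder_site X" "subcanonical X"
    and Y: "preorder_site Y" "subcanonical Y" "Partial_order (leq Y)"
    and f: "monotone_map X Y f" "f \<in> extensional (elems X)"
    and g: "monotone_map X Y g" "g \<in> extensional (elems X)"
    and eq: "ideal_locale_map (X, Y, f) = ideal_locale_map (X, Y, g)"
  shows "f = g"
proof (rule extensionalityI[OF f(2) g(2)])
  fix c assume c: "c \<in> elems X"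
  have "ideal_generated Y (f ` under (leq X) c) = ideal_generated Y (g ` under (leq X) c)"
    using eq under_J_ideal[OF X c] by (auto dest!: fun_cong[of _ _ "under (leq X) c"])
  then have "under (leq Y) (f c) = under (leq Y) (g c)"
    using ideal_generated_image_under[OF X(1) Y(1,2) _ c] f(1) g(1) by simp
  then have "(f c, g c) \<in> leq Y" "(g c, f c) \<in> leq Y"
    using preorder_site_refl[OF Y(1) monotone_map_elems[OF f(1) c]]
      preorder_site_refl[OF Y(1) monotone_map_elems[OF g(1) c]]
    by (auto simp: under_def)
  then show "f c = g c" using Y(3) by (auto simp: partial_order_on_def dest: antisymD)
qed


section \<open>Functoriality and the isomorphism\<close>

text \<open>The endpoints of an arrow of \<open>K\<close> are objects of \<open>K\<close>, and not just of \<open>PreTop\<close>, because \<open>K\<close> is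
  a category with the same domains and codomains; so what is assumed of the objects of \<open>K\<close>
  applies to them.\<close>

lemma subcategory_PreTopD:
  assumes K: "subcategory K PreTop"
  shows PreTop_obj: "X \<in> Obj K \<Longrightarrow> preorder_site X"
    and PreTop_ident: "X \<in> Obj K \<Longrightarrow> Ident K X = (X, X, \<lambda>x\<in>elems X. x)"
    and PreTop_arr: "(X, Y, f) \<in> Arr K \<Longrightarrow> Dom K (X, Y, f) = X \<and> Cod K (X, Y, f) = Y \<and>
      X \<in> Obj K \<and> Y \<in> Obj K \<and> f \<in> extensional (elems X)"
    and PreTop_comp: "(X, Y, f) \<in> Arr K \<Longrightarrow> (Y, Z, g) \<in> Arr K \<Longrightarrow>
      Comp K (Y, Z, g) (X, Y, f) = (X, Z, compose (elems X) g f)"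
proof -
  have cat: "category K" using K by (simp add: subcategory_def)
  show "X \<in> Obj K \<Longrightarrow> preorder_site X"
    using K by (auto simp: subcategory_def PreTop_def concrete_cat_def)
  show "X \<in> Obj K \<Longrightarrow> Ident K X = (X, X, \<lambda>x\<in>elems X. x)"
    using K by (auto simp: subcategory_def PreTop_def concrete_cat_def)
  have arr: "Dom K (X, Y, f) = X \<and> Cod K (X, Y, f) = Y" if "(X, Y, f) \<in> Arr K" for X Y f
    using K that by (auto simp: subcategory_def PreTop_def concrete_cat_def)
  show "(X, Y, f) \<in> Arr K \<Longrightarrow> Dom K (X, Y, f) = X \<and> Cod K (X, Y, f) = Y \<and>
      X \<in> Obj K \<and> Y \<in> Obj K \<and> f \<in> extensional (elems X)"
  proof (intro conjI)
    assume a: "(X, Y, f) \<in> Arr K"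
    show "Dom K (X, Y, f) = X" "Cod K (X, Y, f) = Y" using arr[OF a] by auto
    show "X \<in> Obj K" "Y \<in> Obj K"
      using category.dom_closed[OF cat a] category.cod_closed[OF cat a] arr[OF a] by simp_all
    have "(X, Y, f) \<in> Arr PreTop" using K a by (auto simp: subcategory_def)
    then show "f \<in> extensional (elems X)" by (auto simp: PreTop_def concrete_cat_def PiE_def)
  qed
  show "(X, Y, f) \<in> Arr K \<Longrightarrow> (Y, Z, g) \<in> Arr K \<Longrightarrow>
      Comp K (Y, Z, g) (X, Y, f) = (X, Z, compose (elems X) g f)"
  proof -
    assume a: "(X, Y, f) \<in> Arr K" "(Y, Z, g) \<in> Arr K"
    then have "Comp K (Y, Z, g) (X, Y, f) = Comp PreTop (Y, Z, g) (X, Y, f)"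
      using K arr[OF a(1)] arr[OF a(2)] unfolding subcategory_def by metis
    then show ?thesis by (simp add: PreTop_def concrete_cat_def)
  qed
qed

lemma ideal_locale_map_ident:
  "ideal_locale_map (X, X, \<lambda>x\<in>elems X. x) = (ideal_locale X, ideal_locale X, \<lambda>I\<in>J_ideals X. I)"
proof -
  have "(\<lambda>x\<in>elems X. x) ` I = I" if "I \<in> J_ideals X" for I
    using J_ideals_subset[OF that] by force
  then show ?thesis by (auto simp: ideal_generated_same intro!: restrict_ext)
qed

lemma ideal_locale_map_comp:
  assumes Y: "preorder_site Y" and Z: "preorder_site Z"
    and f: "monotone_map X Y f"
    and g: "monotone_map Y Z g" "cover_preserving Y Z g"
  shows "ideal_locale_map (X, Z, compose (elems X) g f) =
    (ideal_locale X, ideal_locale Z, compose (J_ideals X)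
      (\<lambda>I\<in>J_ideals Y. ideal_generated Z (g ` I)) (\<lambda>I\<in>J_ideals X. ideal_generated Y (f ` I)))"
proof -
  have "ideal_generated Z (compose (elems X) g f ` I)
      = (\<lambda>I\<in>J_ideals Y. ideal_generated Z (g ` I)) (ideal_generated Y (f ` I))"
    if I: "I \<in> J_ideals X" for I
  proof -
    have fI: "f ` I \<subseteq> elems Y" using J_ideals_subset[OF I] monotone_map_elems[OF f] by auto
    have "compose (elems X) g f ` I = g ` f ` I"
      using J_ideals_subset[OF I] by (force simp: compose_def)
    then show ?thesis
      using ideal_generated_image[OF Y Z g fI] ideal_generated_J_ideal[OF Y fI] by simp
  qed
  then show ?thesis by (auto simp: compose_def intro!: restrict_ext)
qed

text \<open>Passing to \<open>op_cat\<close> on both sides cancels: the frame homomorphism of \<open>f\<close> points in the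
  direction of \<open>f\<close>.\<close>

lemma ideal_locale_functor:
  assumes K: "subcategory K PreTop"
    and sm: "\<And>X Y f. (X, Y, f) \<in> Arr K \<Longrightarrow> site_morphism X Y f"
  shows "is_functor (op_cat K) Loc ideal_locale ideal_locale_map"
  unfolding is_functor_def
proof (intro conjI ballI impI)
  show "category (op_cat K)" using K by (intro op_category) (simp add: subcategory_def)
  show "category Loc" by (rule Loc_category)
next
  fix X assume "X \<in> Obj (op_cat K)"
  then have X: "X \<in> Obj K" by (simp add: op_cat_def)
  show "ideal_locale X \<in> Obj Loc"
    using ideal_locale_frame[OF PreTop_obj[OF K X]]
    by (simp add: Loc_def Frm_def op_cat_def concrete_cat_def)
  show "ideal_locale_map (Ident (op_cat K) X) = Ident Loc (ideal_locale X)"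
    using PreTop_ident[OF K X] ideal_locale_map_ident[of X]
    by (simp add: Loc_def Frm_def op_cat_def concrete_cat_def del: ideal_locale_map.simps)
next
  fix u assume "u \<in> Arr (op_cat K)"
  then obtain X Y f where u: "u = (X, Y, f)" "(X, Y, f) \<in> Arr K"
    by (cases u) (auto simp: op_cat_def)
  note a = PreTop_arr[OF K u(2)]
  have X: "preorder_site X" and Y: "preorder_site Y" using PreTop_obj[OF K] a by auto
  have hom: "frame_hom (ideal_locale X) (ideal_locale Y) (\<lambda>I\<in>J_ideals X. ideal_generated Y (f ` I))"
    by (rule site_morphism_frame_hom[OF X Y sm[OF u(2)]])
  then have "(\<lambda>I\<in>J_ideals X. ideal_generated Y (f ` I)) \<in> J_ideals X \<rightarrow>\<^sub>E J_ideals Y"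
    by (auto simp: frame_hom_def PiE_def)
  then show "ideal_locale_map u \<in> Arr Loc"
    using hom ideal_locale_frame[OF X] ideal_locale_frame[OF Y] u(1)
    by (simp add: Loc_def Frm_def op_cat_def concrete_cat_def)
  show "Dom Loc (ideal_locale_map u) = ideal_locale (Dom (op_cat K) u)"
    "Cod Loc (ideal_locale_map u) = ideal_locale (Cod (op_cat K) u)"
    using u(1) a by (simp_all add: Loc_def Frm_def op_cat_def concrete_cat_def)
  fix v assume "v \<in> Arr (op_cat K)" and uv: "Cod (op_cat K) u = Dom (op_cat K) v"
  then obtain W X' g where "v = (W, X', g)" "(W, X', g) \<in> Arr K"
    by (cases v) (auto simp: op_cat_def)
  moreover from this have "X' = X" using uv a u(1) PreTop_arr[OF K] by (simp add: op_cat_def)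
  ultimately have v: "v = (W, X, g)" "(W, X, g) \<in> Arr K" by simp_all
  have "Comp (op_cat K) v u = (W, Y, compose (elems W) f g)"
    using PreTop_comp[OF K v(2) u(2)] u(1) v(1) by (simp add: op_cat_def)
  moreover have "monotone_map W X g" "monotone_map X Y f" "cover_preserving X Y f"
    using sm[OF u(2)] sm[OF v(2)] by (simp_all add: site_morphism_def)
  ultimately show "ideal_locale_map (Comp (op_cat K) v u)
      = Comp Loc (ideal_locale_map v) (ideal_locale_map u)"
    using ideal_locale_map_comp[OF X Y, of W g f] u(1) v(1)
    by (simp add: Loc_def Frm_def op_cat_def concrete_cat_def)
qed

theorem theorem3p5:
  fixes K :: "('a psite, ('a psite, 'a) arrow) cat"
  assumes "subcategory K PreTop"
    and "\<And>X Y f. (X, Y, f) \<in> Arr K \<Longrightarrow> site_morphism X Y f"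
    and "\<And>X. X \<in> Obj K \<Longrightarrow> subcanonical X"
    and "\<And>X. X \<in> Obj K \<Longrightarrow> Partial_order (leq X)"
  shows "is_functor (op_cat K) Loc ideal_locale ideal_locale_map
    \<and> subcategory (image_cat (op_cat K) Loc ideal_locale ideal_locale_map) Loc
    \<and> is_cat_isomorphism (op_cat K) (image_cat (op_cat K) Loc ideal_locale ideal_locale_map)
        ideal_locale ideal_locale_map"
proof -
  note K = assms(1)
  have obj: "preorder_site X" "subcanonical X" "Partial_order (leq X)" if "X \<in> Obj K" for X
    using that PreTop_obj[OF K] assms(3,4) by auto
  have F: "is_functor (op_cat K) Loc ideal_locale ideal_locale_map"
    by (rule ideal_locale_functor[OF assms(1,2)])
  have injo: "inj_on ideal_locale (Obj (op_cat K))"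
    using ideal_locale_inj obj by (auto simp: inj_on_def op_cat_def)
  have injm: "inj_on ideal_locale_map (Arr (op_cat K))"
  proof (rule inj_onI)
    fix u v
    assume u: "u \<in> Arr (op_cat K)" and v: "v \<in> Arr (op_cat K)"
      and eq: "ideal_locale_map u = ideal_locale_map v"
    obtain X Y f X' Y' g where uv: "u = (X, Y, f)" "v = (X', Y', g)" by (metis prod_cases3)
    have uK: "(X, Y, f) \<in> Arr K" and vK: "(X', Y', g) \<in> Arr K"
      using u v uv by (simp_all add: op_cat_def)
    have "ideal_locale X = ideal_locale X'" "ideal_locale Y = ideal_locale Y'"
      using eq uv by simp_all
    then have same: "X' = X" "Y' = Y"
      using injo PreTop_arr[OF K uK] PreTop_arr[OF K vK] by (auto simp: inj_on_def op_cat_def)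
    have vK': "(X, Y, g) \<in> Arr K" using vK same by simp
    have "f = g"
    proof (rule ideal_locale_map_inj)
      show "monotone_map X Y f" "monotone_map X Y g"
        using assms(2)[OF uK] assms(2)[OF vK'] by (simp_all add: site_morphism_def)
      show "f \<in> extensional (elems X)" "g \<in> extensional (elems X)"
        using PreTop_arr[OF K uK] PreTop_arr[OF K vK'] by simp_all
      show "ideal_locale_map (X, Y, f) = ideal_locale_map (X, Y, g)" using eq uv same by simp
    qed (use obj PreTop_arr[OF K uK] in auto)
    then show "u = v" using uv same by simp
  qed
  show ?thesis
    using F image_cat_subcategory[OF F injo] image_cat_isomorphism[OF F injo injm] by simp
qed

end
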